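(* Let $B\subset\mathbf{Z}$ be finite and suppose that for each $i\in[J]$ there exist $q_i\in\mathbf{N}$ and $r_i\in\mathbf{Z}/q_i\mathbf{Z}$ such that: (i) writing $B_i=B\cap\{n\in\mathbf{Z}:n\equiv r_i\pmod{q_i}\}$, we have $|B_{i+1}|>10|B_i|$ for all $i<J$; (ii) $q_1\mid q_2\mid\dots\mid q_J$, and the residue classes $\{n\in\mathbf{Z}:n\equiv r_i\pmod{q_i}\}$, $i\in[J]$, are pairwise disjoint. If $E\in L^1(\mathbf{T})$ is a function such that $\lVert\mathrm{Proj}(E;r_i\bmod q_i)\rVert_2\leqslant|B_i|^{1/2}/10$ for each $i\in[J]$, then $\lVert\hat 1_B+E\rVert_1\gg J$.
   Context: $\mathbf{T}=\mathbf{R}/\mathbf{Z}$, $e(t)=e^{2\pi it}$; for $E\in L^1(\mathbf{T})$, $\hat E(n)=\int_{\mathbf{T}}E(t)e(-nt)\,dt$, and $\mathrm{Proj}(E;r\bmod q)(x)=\sum_{k\equiv r\pmod q}\hat E(k)e(kx)$ is the function obtained by keeping only Fourier coefficients with frequencies in the class $r\bmod q$. $\hat 1_B(x)=\sum_{n\in B}e(nx)$. $\lVert g\rVert_p=(\int_0^1|g|^p)^{1/p}$. $X\gg Y$ means $X\geqslant cY$ for an absolute constant $c>0$.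
   Formalization: When J = 1 the set B_1 is additionally assumed to be nonempty; without this the claim fails, e.g. for J = 1, B empty and E = 0, where the norm is 0. *)

theory Defs
  imports "HOL-Analysis.Analysis" "HOL-Number_Theory.Cong"
begin

definition unit_exp :: "real \<Rightarrow> complex" where
  "unit_exp t = exp (2 * complex_of_real pi * \<i> * complex_of_real t)"

text \<open>Elements of $L^1$ of the circle are represented by 1-periodic functions on the
  real line whose restriction to a period is Lebesgue integrable.\<close>

definition L1_circle :: "(real \<Rightarrow> complex) set" where
  "L1_circle = {f. (\<forall>t. f (t + 1) = f t) \<and> f absolutely_integrable_on {0..1}}"

text \<open>The norm takes the value \<open>\<infinity>\<close> on functions outside $L^p$, so an upper bound on it
  includes membership in $L^p$.\<close>

definition Lp_norm :: "real \<Rightarrow> (real \<Rightarrow> complex) \<Rightarrow> ennreal" where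
  "Lp_norm p f =
     (let I = (\<integral>\<^sup>+ t \<in> {0..1}. ennreal (norm (f t) powr p) \<partial>lebesgue)
      in if I = \<infinity> then \<infinity> else ennreal (enn2real I powr (1 / p)))"

definition fourier_coeff :: "(real \<Rightarrow> complex) \<Rightarrow> int \<Rightarrow> complex" where
  "fourier_coeff f n = integral {0..1} (\<lambda>t. f t * unit_exp (- real_of_int n * t))"

definition residue_class :: "int \<Rightarrow> nat \<Rightarrow> int set" where
  "residue_class r q = {n. [n = r] (mod int q)}"

text \<open>For general $L^1$ functions the Fourier series of the projection need not converge to it, so
  the projection is the $L^1$ function with the prescribed Fourier coefficients. It exists by
  \<open>Proj_exists\<close> below and is determined up to a null set.\<close>

definition Proj :: "(real \<Rightarrow> complex) \<Rightarrow> int \<Rightarrow> nat \<Rightarrow> real \<Rightarrow> complex" where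
  "Proj f r q = (SOME g. g \<in> L1_circle \<and>
     (\<forall>k. fourier_coeff g k = (if k \<in> residue_class r q then fourier_coeff f k else 0)))"

definition exp_sum :: "int set \<Rightarrow> real \<Rightarrow> complex" where
  "exp_sum B t = (\<Sum>n\<in>B. unit_exp (real_of_int n * t))"

lemma has_integral_periodic_shift:
  fixes g :: "real \<Rightarrow> 'a::euclidean_space"
  assumes g: "(g has_integral I) {0..1}" and per: "\<And>t. g (t + 1) = g t"
    and a: "0 \<le> a" "a \<le> 1"
  shows "((\<lambda>t. g (t + a)) has_integral I) {0..1}"
proof -
  have int: "g integrable_on {0..1}"
    using g by blast
  define I1 where "I1 = integral {0..a} g"
  define I2 where "I2 = integral {a..1} g"
  have h1: "(g has_integral I1) {0..a}"
    unfolding I1_def using a int integrable_integral integrable_on_subinterval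
    by (metis atLeastatMost_subset_iff order_refl)
  have h2: "(g has_integral I2) {a..1}"
    unfolding I2_def using a int integrable_integral integrable_on_subinterval
    by (metis atLeastatMost_subset_iff order_refl)
  have "(g has_integral (I1 + I2)) {0..1}"
    by (rule has_integral_combine[OF a h1 h2])
  then have I: "I = I2 + I1"
    using g has_integral_unique by (metis add.commute)
  have s2: "((\<lambda>t. g (t + a)) has_integral I2) {0..1 - a}"
    using has_integral_shift_Icc_real[of g a I2 0 "1 - a"] h2 by (simp add: o_def add.commute)
  have per': "g (t + (a - 1)) = g (t + a)" for t
    using per[of "t + (a - 1)"] by (simp add: algebra_simps)
  have s1: "((\<lambda>t. g (t + a)) has_integral I1) {1 - a..1}"
    using has_integral_shift_Icc_real[of g "a - 1" I1 "1 - a" 1] h1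
    by (simp add: o_def per' add.commute[of "a - 1"])
  show ?thesis
    unfolding I by (rule has_integral_combine[OF _ _ s2 s1]) (use a in auto)
qed

lemma unit_exp_add: "unit_exp (s + t) = unit_exp s * unit_exp t"
  by (simp add: unit_exp_def ring_distribs exp_add)

lemma unit_exp_of_int [simp]: "unit_exp (of_int n) = 1"
  unfolding unit_exp_def by (subst exp_eq_1) (auto intro!: exI[of _ n])

lemma norm_unit_exp [simp]: "norm (unit_exp t) = 1"
  by (simp add: unit_exp_def)

lemma unit_exp_power: "unit_exp t ^ n = unit_exp (real n * t)"
  by (simp add: unit_exp_def flip: exp_of_nat_mult) (simp add: mult_ac)

lemma continuous_unit_exp: "continuous_on S (\<lambda>t. unit_exp (c * t))"
  unfolding unit_exp_def by (intro continuous_intros)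

lemma L1_circle_shift:
  assumes f: "f \<in> L1_circle" and a: "0 \<le> a" "a \<le> 1"
  shows "(\<lambda>t. f (t + a)) \<in> L1_circle"
proof -
  have per: "f (t + 1) = f t" for t
    using f by (auto simp: L1_circle_def)
  have per': "f (t + 1 + a) = f (t + a)" for t
    using per[of "t + a"] by (simp add: algebra_simps)
  have "f integrable_on {0..1}" "(\<lambda>t. norm (f t)) integrable_on {0..1}"
    using f by (auto simp: L1_circle_def absolutely_integrable_on_def)
  then have "(\<lambda>t. f (t + a)) integrable_on {0..1}" "(\<lambda>t. norm (f (t + a))) integrable_on {0..1}"
    using has_integral_periodic_shift[of f _ a] has_integral_periodic_shift[of "\<lambda>t. norm (f t)" _ a] a
    by (auto simp: per integrable_on_def)
  with per' show ?thesis
    by (auto simp: L1_circle_def absolutely_integrable_on_def)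
qed

lemma L1_circle_times_unit_exp:
  assumes f: "f \<in> L1_circle"
  shows "(\<lambda>t. f t * unit_exp (c * t)) absolutely_integrable_on {0..1}"
proof -
  have "(\<lambda>t. unit_exp (c * t) * f t) absolutely_integrable_on {0..1}"
    by (rule absolutely_integrable_bounded_measurable_product[OF bilinear_times])
      (use f in \<open>auto simp: L1_circle_def bounded_iff
        intro!: continuous_imp_measurable_on_sets_lebesgue continuous_unit_exp\<close>)
  then show ?thesis
    by (simp add: mult.commute)
qed

lemma fourier_coeff_shift:
  assumes f: "f \<in> L1_circle" and a: "0 \<le> a" "a \<le> 1"
  shows "fourier_coeff (\<lambda>t. f (t + a)) k = unit_exp (real_of_int k * a) * fourier_coeff f k"
proof -
  let ?g = "\<lambda>t. f t * unit_exp (- real_of_int k * t)"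
  have "(?g has_integral fourier_coeff f k) {0..1}"
    unfolding fourier_coeff_def
    using L1_circle_times_unit_exp[OF f, of "- real_of_int k"]
    by (simp add: absolutely_integrable_on_def integrable_integral)
  moreover have "?g (t + 1) = ?g t" for t
    using f unit_exp_of_int[of "- k"]
    by (simp add: L1_circle_def ring_distribs unit_exp_add del: unit_exp_of_int flip: of_int_minus)
  ultimately have "((\<lambda>t. ?g (t + a)) has_integral fourier_coeff f k) {0..1}"
    by (rule has_integral_periodic_shift) (use a in auto)
  then have "((\<lambda>t. unit_exp (real_of_int k * a) * ?g (t + a)) has_integral
      unit_exp (real_of_int k * a) * fourier_coeff f k) {0..1}"
    by (rule has_integral_mult_right)
  moreover have "unit_exp (real_of_int k * a) * ?g (t + a) =
      f (t + a) * unit_exp (- real_of_int k * t)" for t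
    by (simp add: algebra_simps flip: unit_exp_add)
  ultimately have "((\<lambda>t. f (t + a) * unit_exp (- real_of_int k * t)) has_integral
      unit_exp (real_of_int k * a) * fourier_coeff f k) {0..1}"
    by (simp only:)
  then show ?thesis
    unfolding fourier_coeff_def[of "\<lambda>t. f (t + a)"] by (rule integral_unique)
qed

lemma sum_unit_exp_residue:
  assumes "q > 0"
  shows "(\<Sum>j<q. unit_exp (real_of_int m * (real j / real q))) =
    (if int q dvd m then of_nat q else 0)"
proof -
  let ?w = "unit_exp (real_of_int m / real q)"
  have eq: "unit_exp (real_of_int m * (real j / real q)) = ?w ^ j" for j
    by (simp add: unit_exp_power mult_ac)
  have w1: "?w = 1 \<longleftrightarrow> int q dvd m"
  proof
    assume "?w = 1"
    then obtain n :: int where "2 * pi * (real_of_int m / real q) = of_int (2 * n) * pi"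
      by (auto simp: unit_exp_def exp_eq_1)
    then have "real_of_int m = real_of_int (n * int q)"
      using assms by (simp add: field_simps)
    then have "m = n * int q"
      by (simp only: of_int_eq_iff)
    then show "int q dvd m"
      by simp
  next
    assume "int q dvd m"
    then obtain n where "m = int q * n" ..
    then have "real_of_int m / real q = of_int n"
      using assms by simp
    then show "?w = 1"
      by (metis unit_exp_of_int)
  qed
  have "?w ^ q = 1"
    using assms by (simp add: unit_exp_power)
  then show ?thesis
    using w1 geometric_sum[of ?w q] by (cases "?w = 1") (simp_all only: eq, simp_all)
qed

lemma Proj_exists:
  assumes f: "f \<in> L1_circle" and q: "q > 0"
  shows "\<exists>g \<in> L1_circle. \<forall>k.
    fourier_coeff g k = (if k \<in> residue_class r q then fourier_coeff f k else 0)"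
proof -
  define c where "c j = unit_exp (- real_of_int r * (real j / real q)) / of_nat q" for j
  define s where "s j = (\<lambda>t. f (t + real j / real q))" for j
  define g where "g t = (\<Sum>j<q. c j * s j t)" for t
  have s: "s j \<in> L1_circle" if "j < q" for j
    unfolding s_def using f that by (intro L1_circle_shift) auto
  have "g \<in> L1_circle"
    using s unfolding L1_circle_def g_def
    by (auto intro!: absolutely_integrable_sum set_integrable_mult_right sum.cong)
  moreover have "fourier_coeff g k = (if k \<in> residue_class r q then fourier_coeff f k else 0)" for k
  proof -
    have int: "(\<lambda>t. s j t * unit_exp (- real_of_int k * t)) integrable_on {0..1}" if "j < q" for j
      using L1_circle_times_unit_exp[OF s[OF that]] unfolding absolutely_integrable_on_def by blast
    have "fourier_coeff g k =
        integral {0..1} (\<lambda>t. \<Sum>j<q. c j * (s j t * unit_exp (- real_of_int k * t)))"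
      by (simp only: fourier_coeff_def g_def sum_distrib_right mult.assoc)
    also have "\<dots> = (\<Sum>j<q. c j * fourier_coeff (s j) k)"
      using int by (subst integral_sum) (auto simp: fourier_coeff_def intro!: integrable_on_mult_right)
    also have "\<dots> = (\<Sum>j<q. unit_exp (real_of_int (k - r) * (real j / real q))
        * (fourier_coeff f k / of_nat q))"
    proof (rule sum.cong)
      fix j assume "j \<in> {..<q}"
      then have "fourier_coeff (s j) k =
          unit_exp (real_of_int k * (real j / real q)) * fourier_coeff f k"
        unfolding s_def using f by (intro fourier_coeff_shift) auto
      moreover have "unit_exp (real_of_int (k - r) * (real j / real q)) =
          unit_exp (- real_of_int r * (real j / real q)) * unit_exp (real_of_int k * (real j / real q))"
        by (simp add: ring_distribs diff_divide_distrib flip: unit_exp_add)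
      ultimately show "c j * fourier_coeff (s j) k =
          unit_exp (real_of_int (k - r) * (real j / real q)) * (fourier_coeff f k / of_nat q)"
        by (simp add: c_def)
    qed simp
    also have "\<dots> = (if int q dvd k - r then of_nat q else 0) * (fourier_coeff f k / of_nat q)"
      by (simp only: sum_unit_exp_residue[OF q] flip: sum_distrib_right)
    finally show ?thesis
      using q by (auto simp: residue_class_def cong_iff_dvd_diff)
  qed
  ultimately show ?thesis
    by blast
qed

end

(* Put f_i = |B_i|^-1 sum_{n in B_i} e(nx), so that |f_i| <= 1 and the L^2 norm of f_i is |B_i|^(-1/2).
   The theorem follows by pairing with
     Phi = 1/2 sum_j f_j prod_{i > j} (1 - w_i / 2),  w_i close to |f_i|,
   which is bounded by 1 because of the telescoping structure.  Since |f_i| has spectrum in q_i Z, and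
   q_j divides q_i for i > j, the j-th term has spectrum in the class r_j mod q_j, so it sees only
   the projection of the function to that class.  There f_j alone contributes at least
   1 - 1/10, and the damping costs at most 1/2, because the L^2 norms of the f_i with i > j decay
   geometrically.  Taking w_i = p(|f_i|^2) with p a polynomial slightly above the square root
   keeps all test functions trigonometric polynomials, so no uniqueness or convergence theorem for
   Fourier series is needed. *)

theory Submission
  imports Defs
begin

section \<open>Trigonometric polynomials with frequencies in a prescribed set\<close>

text \<open>Adding one monomial at a time gives the induction principle on which the facts about
  spectra rest. Frequencies may repeat, so sums and products need no collecting of coefficients, and
  \<open>S\<close> only has to contain the spectrum.\<close>

inductive trig_poly :: "int set \<Rightarrow> (real \<Rightarrow> complex) \<Rightarrow> bool" for S where
  zero: "trig_poly S (\<lambda>t. 0)"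
| add_monomial: "trig_poly S f \<Longrightarrow> n \<in> S \<Longrightarrow> trig_poly S (\<lambda>t. f t + a * unit_exp (of_int n * t))"

lemma trig_poly_monomial: "n \<in> S \<Longrightarrow> trig_poly S (\<lambda>t. a * unit_exp (of_int n * t))"
  using trig_poly.add_monomial[OF trig_poly.zero, of n S a] by simp

lemma trig_poly_const: "0 \<in> S \<Longrightarrow> trig_poly S (\<lambda>t. a)"
  using trig_poly_monomial[of 0 S a] unit_exp_of_int[of 0] by simp

lemma trig_poly_add:
  assumes "trig_poly S f" "trig_poly S g"
  shows "trig_poly S (\<lambda>t. f t + g t)"
  using assms(2)
proof induction
  case zero
  then show ?case using assms(1) by simp
next
  case (add_monomial g n a)
  then show ?case using trig_poly.add_monomial[of S "\<lambda>t. f t + g t" n a] by (simp add: add.assoc)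
qed

lemma trig_poly_sum:
  assumes "\<And>i. i \<in> I \<Longrightarrow> trig_poly S (f i)"
  shows "trig_poly S (\<lambda>t. \<Sum>i\<in>I. f i t)"
  using assms by (induction I rule: infinite_finite_induct) (simp_all add: trig_poly.zero trig_poly_add)

text \<open>The target set \<open>U\<close> is left free so that one lemma covers a subgroup plus
  itself, a residue class plus a subgroup, and a residue class minus itself.\<close>

lemma trig_poly_mult:
  assumes f: "trig_poly S f" and g: "trig_poly T g" and U: "\<And>s t. s \<in> S \<Longrightarrow> t \<in> T \<Longrightarrow> s + t \<in> U"
  shows "trig_poly U (\<lambda>t. f t * g t)"
proof -
  have *: "trig_poly U (\<lambda>t. f t * (b * unit_exp (of_int m * t)))" if "m \<in> T" for m b
    using f
  proof induction
    case zero
    then show ?case by (simp add: trig_poly.zero)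
  next
    case (add_monomial f n a)
    have "trig_poly U (\<lambda>t. f t * (b * unit_exp (of_int m * t)) + (a * b) * unit_exp (of_int (n + m) * t))"
      by (intro trig_poly.add_monomial add_monomial U that)
    then show ?case
      by (simp add: algebra_simps unit_exp_add)
  qed
  show ?thesis
    using g
  proof induction
    case zero
    then show ?case by (simp add: trig_poly.zero)
  next
    case (add_monomial g n a)
    then show ?case
      using trig_poly_add[OF add_monomial.IH *[OF add_monomial.hyps(2), of a]]
      by (simp add: algebra_simps)
  qed
qed

lemma trig_poly_prod:
  assumes "0 \<in> S" "\<And>m n. m \<in> S \<Longrightarrow> n \<in> S \<Longrightarrow> m + n \<in> S" "\<And>i. i \<in> I \<Longrightarrow> trig_poly S (f i)"
  shows "trig_poly S (\<lambda>t. \<Prod>i\<in>I. f i t)"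
  using assms(3)
proof (induction I rule: infinite_finite_induct)
  case (insert i I)
  then show ?case
    using trig_poly_mult[of S "f i" S "\<lambda>t. \<Prod>i\<in>I. f i t" S] assms(2) by simp
qed (simp_all add: trig_poly_const assms(1))

lemma cnj_unit_exp: "cnj (unit_exp t) = unit_exp (- t)"
  by (simp add: unit_exp_def exp_cnj)

lemma trig_poly_cnj: "trig_poly S f \<Longrightarrow> trig_poly (uminus ` S) (\<lambda>t. cnj (f t))"
proof (induction rule: trig_poly.induct)
  case zero
  then show ?case by (simp add: trig_poly.zero)
next
  case (add_monomial f n a)
  then show ?case
    using trig_poly.add_monomial[OF add_monomial.IH, of "- n" "cnj a"]
    by (simp add: cnj_unit_exp)
qed

text \<open>A set of frequencies that contains 0 and is closed under addition is stable under
  constants, sums and products, hence under polynomials. Later this carries the spectrum of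
  \<open>|f_i|^2\<close> over to the damping weights \<open>w_i\<close>.\<close>

lemma trig_poly_real_polynomial_function:
  fixes p h :: "real \<Rightarrow> real"
  assumes S: "0 \<in> S" "\<And>m n. m \<in> S \<Longrightarrow> n \<in> S \<Longrightarrow> m + n \<in> S"
    and h: "trig_poly S (\<lambda>t. of_real (h t))" and p: "real_polynomial_function p"
  shows "trig_poly S (\<lambda>t. of_real (p (h t)))"
  using p
proof induction
  case (linear f)
  \<comment> \<open>A linear map on the reals is multiplication by its value at 1.\<close>
  have *: "f x = x * f 1" for x
    using linear_scale[OF bounded_linear.linear[OF linear], of x 1] by simp
  have eq: "(\<lambda>t. complex_of_real (f (h t))) = (\<lambda>t. of_real (h t) * of_real (f 1))"
    by (rule ext, subst *, rule of_real_mult)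
  show ?case
    unfolding eq by (rule trig_poly_mult[OF h trig_poly_const[OF S(1)] S(2)])
next
  case (const c)
  then show ?case by (rule trig_poly_const[OF S(1)])
next
  case (add f g)
  then show ?case using trig_poly_add[OF add.IH] by simp
next
  case (mult f g)
  then show ?case using trig_poly_mult[OF mult.IH S(2)] by simp
qed

lemma trig_poly_exp_sum:
  assumes "A \<subseteq> S"
  shows "trig_poly S (exp_sum A)"
proof -
  have "trig_poly S (\<lambda>t. 1 * unit_exp (of_int n * t))" if "n \<in> A" for n
    using that assms by (intro trig_poly_monomial) auto
  then show ?thesis
    unfolding exp_sum_def by (intro trig_poly_sum) simp
qed

section \<open>Pairing integrable functions with trigonometric polynomials\<close>

lemma trig_poly_continuous: "trig_poly S f \<Longrightarrow> continuous_on X f"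
  by (induction rule: trig_poly.induct) (auto intro!: continuous_intros continuous_unit_exp)

lemma trig_poly_periodic: "trig_poly S f \<Longrightarrow> f (t + 1) = f t"
  by (induction rule: trig_poly.induct) (auto simp: ring_distribs unit_exp_add)

lemma trig_poly_L1_circle: "trig_poly S f \<Longrightarrow> f \<in> L1_circle"
  unfolding L1_circle_def
  by (auto simp: trig_poly_periodic intro!: absolutely_integrable_continuous_real trig_poly_continuous)

lemma L1_circle_add: "f \<in> L1_circle \<Longrightarrow> g \<in> L1_circle \<Longrightarrow> (\<lambda>t. f t + g t) \<in> L1_circle"
  by (auto simp: L1_circle_def)

lemma L1_circle_times_cnj_trig_poly:
  assumes f: "f \<in> L1_circle" and "trig_poly S g"
  shows "(\<lambda>t. f t * cnj (g t)) absolutely_integrable_on {0..1}"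
  using assms(2)
proof induction
  case (add_monomial g n a)
  have "(\<lambda>t. f t * cnj (g t) + cnj a * (f t * unit_exp (- of_int n * t))) absolutely_integrable_on {0..1}"
    by (intro set_integral_add set_integrable_mult_right add_monomial L1_circle_times_unit_exp[OF f])
  then show ?case
    by (simp add: algebra_simps cnj_unit_exp)
qed simp

text \<open>Each monomial of \<open>h\<close> contributes one Fourier coefficient at a frequency in
  \<open>S\<close>. This lets a function be replaced by its part in a residue class whenever the
  test function lives in that class, without any convergence of Fourier series.\<close>

lemma fourier_coeff_determines_pairing:
  assumes f: "f \<in> L1_circle" and g: "g \<in> L1_circle"
    and eq: "\<And>k. k \<in> S \<Longrightarrow> fourier_coeff f k = fourier_coeff g k"
    and h: "trig_poly S h"
  shows "integral {0..1} (\<lambda>t. f t * cnj (h t)) = integral {0..1} (\<lambda>t. g t * cnj (h t))"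
  using h
proof induction
  case (add_monomial h n a)
  have step: "integral {0..1} (\<lambda>t. u t * cnj (h t + a * unit_exp (of_int n * t))) =
      integral {0..1} (\<lambda>t. u t * cnj (h t)) + cnj a * fourier_coeff u n" if u: "u \<in> L1_circle" for u
  proof -
    have i1: "(\<lambda>t. u t * cnj (h t)) integrable_on {0..1}"
      using L1_circle_times_cnj_trig_poly[OF u add_monomial.hyps(1)]
      by (rule set_lebesgue_integral_eq_integral)
    have i2: "(\<lambda>t. cnj a * (u t * unit_exp (- of_int n * t))) integrable_on {0..1}"
      using L1_circle_times_unit_exp[OF u, of "- of_int n"]
      by (intro integrable_on_mult_right set_lebesgue_integral_eq_integral)
    have "(\<lambda>t. u t * cnj (h t + a * unit_exp (of_int n * t))) =
        (\<lambda>t. u t * cnj (h t) + cnj a * (u t * unit_exp (- of_int n * t)))"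
      by (simp add: algebra_simps cnj_unit_exp)
    then show ?thesis
      using integral_add[OF i1 i2] by (simp add: fourier_coeff_def)
  qed
  show ?case
    using step[OF f] step[OF g] add_monomial eq by simp
qed simp

section \<open>Orthogonality of characters and the square mean of exponential sums\<close>

lemma integral_unit_exp: "integral {0..1} (\<lambda>t. unit_exp (of_int n * t)) = (if n = 0 then 1 else 0)"
proof (cases "n = 0")
  case True
  then show ?thesis using unit_exp_of_int[of 0] by simp
next
  case False
  define c where "c = 2 * complex_of_real pi * \<i> * of_int n"
  have c: "c \<noteq> 0" using False by (simp add: c_def)
  have "((\<lambda>t. unit_exp (of_int n * t) / c) has_vector_derivative unit_exp (of_int n * t)) (at t within {0..1})" for t
  proof -
    \<comment> \<open>The antiderivative is differentiated as a function of a complex variable and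
      then composed with the embedding of the reals; by periodicity its values at 0 and 1
      agree.\<close>
    have "((\<lambda>z. exp (c * z) / c) has_field_derivative exp (c * of_real t)) (at (of_real t) within of_real ` {0..1})"
      using c by (auto intro!: derivative_eq_intros)
    from field_vector_diff_chain_within[OF has_vector_derivative_of_real[OF DERIV_ident] this]
    show ?thesis
      by (simp add: o_def unit_exp_def c_def mult_ac)
  qed
  then have "((\<lambda>t. unit_exp (of_int n * t)) has_integral
      (unit_exp (of_int n * 1) / c - unit_exp (of_int n * 0) / c)) {0..1}"
    by (intro fundamental_theorem_of_calculus) auto
  then show ?thesis
    using False unit_exp_of_int[of 0] by (auto dest: integral_unique)
qed

lemma fourier_coeff_exp_sum:
  assumes "finite A"
  shows "fourier_coeff (exp_sum A) k = (if k \<in> A then 1 else 0)"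
proof -
  have "fourier_coeff (exp_sum A) k = integral {0..1} (\<lambda>t. \<Sum>n\<in>A. unit_exp (of_int (n - k) * t))"
    by (simp add: fourier_coeff_def exp_sum_def sum_distrib_right left_diff_distrib flip: unit_exp_add)
  also have "\<dots> = (\<Sum>n\<in>A. integral {0..1} (\<lambda>t. unit_exp (of_int (n - k) * t)))"
    using assms by (intro integral_sum integrable_continuous_real continuous_unit_exp)
  also have "\<dots> = (\<Sum>n\<in>A. if n = k then 1 else 0)"
    by (simp only: integral_unit_exp) simp
  finally show ?thesis using assms by simp
qed

lemma exp_sum_L1_circle: "exp_sum A \<in> L1_circle"
  by (rule trig_poly_L1_circle[OF trig_poly_exp_sum[OF order_refl]])

text \<open>Parseval for an exponential sum: expanding only the conjugated factor leaves the Fourier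
  coefficients of the sum at the points of \<open>A\<close>, and each of them is 1.\<close>

lemma integral_exp_sum_cnj:
  assumes "finite A"
  shows "integral {0..1} (\<lambda>t. exp_sum A t * cnj (exp_sum A t)) = of_nat (card A)"
proof -
  have "integral {0..1} (\<lambda>t. exp_sum A t * cnj (exp_sum A t)) =
      integral {0..1} (\<lambda>t. \<Sum>n\<in>A. exp_sum A t * unit_exp (- of_int n * t))"
    by (subst (2) exp_sum_def) (simp add: sum_distrib_left cnj_unit_exp)
  also have "\<dots> = (\<Sum>n\<in>A. fourier_coeff (exp_sum A) n)"
    unfolding fourier_coeff_def
    using L1_circle_times_unit_exp[OF exp_sum_L1_circle]
    by (intro integral_sum assms set_lebesgue_integral_eq_integral) blast
  finally show ?thesis using assms by (simp add: fourier_coeff_exp_sum)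
qed

lemma has_integral_norm_exp_sum_squared:
  assumes "finite A"
  shows "((\<lambda>t. (norm (exp_sum A t))\<^sup>2) has_integral real (card A)) {0..1}"
proof -
  have c: "continuous_on {0..1} (exp_sum A)"
    by (rule trig_poly_continuous[OF trig_poly_exp_sum[OF order_refl]])
  then have "(\<lambda>t. exp_sum A t * cnj (exp_sum A t)) integrable_on {0..1}"
    by (intro integrable_continuous_real continuous_intros)
  then have "((\<lambda>t. exp_sum A t * cnj (exp_sum A t)) has_integral of_nat (card A)) {0..1}"
    using integral_exp_sum_cnj[OF assms] by (simp add: has_integral_integral)
  then show ?thesis
    using has_integral_Re[of "\<lambda>t. exp_sum A t * cnj (exp_sum A t)" "of_nat (card A)" "{0..1}"]
    by (simp flip: complex_norm_square of_real_power)
qed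

lemma norm_exp_sum_le: "norm (exp_sum A t) \<le> real (card A)"
  unfolding exp_sum_def by (rule order_trans[OF norm_sum]) simp

section \<open>Translating \<open>Lp_norm\<close> into integrals over the unit interval\<close>

lemma nn_integral_Icc_lebesgue:
  assumes nonneg: "\<And>x. f x \<ge> (0::real)" and f: "(f has_integral I) {0..1::real}"
  shows "(\<integral>\<^sup>+ t \<in> {0..1}. ennreal (f t) \<partial>lebesgue) = ennreal I"
proof -
  have "((\<lambda>x. if x \<in> {0..1} then f x else 0) has_integral I) UNIV"
    using f by (simp only: has_integral_restrict_UNIV)
  then have "(\<integral>\<^sup>+ x. ennreal (if x \<in> {0..1} then f x else 0) \<partial>lebesgue) = ennreal I"
    by (subst (asm) has_integral_iff_nn_integral_lebesgue) (use nonneg in auto)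
  moreover have "(\<integral>\<^sup>+ x. ennreal (if x \<in> {0..1} then f x else 0) \<partial>lebesgue) =
      (\<integral>\<^sup>+ t \<in> {0..1}. ennreal (f t) \<partial>lebesgue)"
    by (rule nn_integral_cong) (auto simp: indicator_def)
  ultimately show ?thesis by simp
qed

lemma Lp_norm_1_L1_circle:
  assumes "f \<in> L1_circle"
  shows "Lp_norm 1 f = ennreal (integral {0..1} (\<lambda>t. norm (f t)))"
proof -
  have "(\<lambda>t. norm (f t)) integrable_on {0..1}"
    using assms by (auto simp: L1_circle_def absolutely_integrable_on_def)
  then have "(\<integral>\<^sup>+ t \<in> {0..1}. ennreal (norm (f t)) \<partial>lebesgue) = ennreal (integral {0..1} (\<lambda>t. norm (f t)))"
    by (intro nn_integral_Icc_lebesgue) auto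
  then show ?thesis
    by (simp add: Lp_norm_def integral_nonneg)
qed

lemma Lp_norm_2_leD:
  assumes f: "f \<in> L1_circle" and le: "Lp_norm 2 f \<le> ennreal C" and C: "C \<ge> 0"
  obtains I where "((\<lambda>t. (norm (f t))\<^sup>2) has_integral I) {0..1}" "I \<le> C\<^sup>2"
proof -
  define N where "N = (\<integral>\<^sup>+ t \<in> {0..1}. ennreal (norm (f t) powr 2) \<partial>lebesgue)"
  have Lp: "Lp_norm 2 f = (if N = \<infinity> then \<infinity> else ennreal (enn2real N powr (1 / 2)))"
    unfolding Lp_norm_def N_def Let_def ..
  \<comment> \<open>The finite bound excludes the infinite branch of \<open>Lp_norm\<close>, so
    \<open>enn2real N\<close> is the true integral and not the default value 0.\<close>
  then have N: "N \<noteq> \<infinity>"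
    using le by (auto simp: top_unique)
  then have "enn2real N powr (1/2) \<le> C"
    using le C Lp by simp
  then have "(sqrt (enn2real N))\<^sup>2 \<le> C\<^sup>2"
    by (intro power_mono) (auto simp: powr_half_sqrt)
  then have I: "enn2real N \<le> C\<^sup>2" by simp
  let ?h = "\<lambda>x. if x \<in> {0..1} then (norm (f x))\<^sup>2 else 0"
  have "N = (\<integral>\<^sup>+ x. ennreal (?h x) \<partial>lebesgue)"
    unfolding N_def by (rule nn_integral_cong) (auto simp: indicator_def powr_numeral)
  \<comment> \<open>A finite nonnegative integral does not by itself give measurability; this comes
    from membership in \<open>L1_circle\<close>.\<close>
  moreover have "?h \<in> borel_measurable lebesgue"
  proof -
    have "f \<in> borel_measurable (lebesgue_on {0..1})"
      using f by (auto simp: L1_circle_def absolutely_integrable_measurable)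
    then have "(\<lambda>x. (norm (f x))\<^sup>2) \<in> borel_measurable (lebesgue_on {0..1})"
      by measurable
    then show ?thesis
      by (subst borel_measurable_if) simp_all
  qed
  ultimately have "(?h has_integral enn2real N) UNIV"
    using N by (subst has_integral_iff_nn_integral_lebesgue) (auto simp: less_top)
  then show ?thesis
    using I that by (simp only: has_integral_restrict_UNIV)
qed

section \<open>Projections and arithmetic of residue classes\<close>

lemma trig_poly_mono: "trig_poly S f \<Longrightarrow> S \<subseteq> T \<Longrightarrow> trig_poly T f"
  by (induction rule: trig_poly.induct) (auto intro: trig_poly.intros)

lemma fourier_coeff_add:
  assumes f: "f \<in> L1_circle" and g: "g \<in> L1_circle"
  shows "fourier_coeff (\<lambda>t. f t + g t) k = fourier_coeff f k + fourier_coeff g k"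
proof -
  have "(\<lambda>t. h t * unit_exp (- of_int k * t)) integrable_on {0..1}" if "h \<in> L1_circle" for h
    using L1_circle_times_unit_exp[OF that] by (rule set_lebesgue_integral_eq_integral)
  from integral_add[OF this[OF f] this[OF g]] show ?thesis
    by (simp add: fourier_coeff_def distrib_right)
qed

lemma Proj_L1_circle: "f \<in> L1_circle \<Longrightarrow> q > 0 \<Longrightarrow> Proj f r q \<in> L1_circle"
  and fourier_coeff_Proj: "f \<in> L1_circle \<Longrightarrow> q > 0 \<Longrightarrow>
    fourier_coeff (Proj f r q) k = (if k \<in> residue_class r q then fourier_coeff f k else 0)"
proof -
  assume "f \<in> L1_circle" "q > 0"
  then have "\<exists>g. g \<in> L1_circle \<and>
      (\<forall>k. fourier_coeff g k = (if k \<in> residue_class r q then fourier_coeff f k else 0))"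
    using Proj_exists[of f q r] by blast
  then have *: "Proj f r q \<in> L1_circle \<and> (\<forall>k. fourier_coeff (Proj f r q) k =
      (if k \<in> residue_class r q then fourier_coeff f k else 0))"
    unfolding Proj_def by (rule someI_ex)
  then show "Proj f r q \<in> L1_circle" by (rule conjunct1)
  show "fourier_coeff (Proj f r q) k = (if k \<in> residue_class r q then fourier_coeff f k else 0)"
    using * by blast
qed

lemma residue_class_add:
  assumes "m \<in> residue_class r q" "n \<in> residue_class 0 q"
  shows "m + n \<in> residue_class r q"
  using cong_add[of m r "int q" n 0] assms by (simp add: residue_class_def)

lemma residue_class_diff:
  assumes "m \<in> residue_class r q" "n \<in> residue_class r q"
  shows "m - n \<in> residue_class 0 q"
  using cong_diff[of m r "int q" n r] assms by (simp add: residue_class_def)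

lemma residue_class_0_antimono: "q dvd q' \<Longrightarrow> residue_class 0 q' \<subseteq> residue_class 0 q"
  unfolding residue_class_def by (auto simp: cong_0_iff intro: dvd_trans)

section \<open>Inequalities for damping products and the polynomial square root\<close>

text \<open>The Weierstrass product inequality; it bounds the loss caused by damping by a sum over
  the single factors.\<close>

lemma one_minus_sum_le_prod:
  fixes x :: "'a \<Rightarrow> real"
  assumes "\<And>i. i \<in> I \<Longrightarrow> 0 \<le> x i \<and> x i \<le> 1"
  shows "1 - (\<Sum>i\<in>I. x i) \<le> (\<Prod>i\<in>I. 1 - x i)"
  using assms
proof (induction I rule: infinite_finite_induct)
  case (insert i I)
  have "(\<Prod>i\<in>I. 1 - x i) \<le> 1"
    using insert.prems by (intro prod_le_1) auto
  then have "x i * (\<Prod>i\<in>I. 1 - x i) \<le> x i * 1"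
    using insert.prems by (intro mult_left_mono) auto
  then show ?case
    using insert by (simp add: algebra_simps)
qed simp_all

text \<open>With \<open>x j\<close> in place of \<open>z j\<close> the sum telescopes exactly to the
  right-hand side. This keeps the whole test function bounded by 1 however many terms it
  has.\<close>

lemma norm_telescoping_sum_le:
  fixes z :: "nat \<Rightarrow> complex" and x :: "nat \<Rightarrow> real"
  assumes "\<And>i. i \<in> {1..n} \<Longrightarrow> norm (z i) \<le> x i \<and> x i \<le> 1"
  shows "norm (\<Sum>j\<in>{1..n}. z j * of_real (\<Prod>i\<in>{j+1..n}. 1 - x i)) \<le> 1 - (\<Prod>i\<in>{1..n}. 1 - x i)"
  using assms
proof (induction n)
  case (Suc n)
  let ?s = "\<lambda>n. \<Sum>j\<in>{1..n}. z j * of_real (\<Prod>i\<in>{j+1..n}. 1 - x i)"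
  let ?P = "\<Prod>i\<in>{1..n}. 1 - x i"
  have x: "norm (z (Suc n)) \<le> x (Suc n)" "x (Suc n) \<le> 1"
    using Suc.prems by auto
  have "(\<Sum>j\<in>{1..n}. z j * of_real (\<Prod>i\<in>{j+1..Suc n}. 1 - x i)) =
      (\<Sum>j\<in>{1..n}. z j * of_real (\<Prod>i\<in>{j+1..n}. 1 - x i) * of_real (1 - x (Suc n)))"
    by (rule sum.cong) (simp_all add: prod.cl_ivl_Suc)
  \<comment> \<open>The new term carries an empty product and so enters undamped, while every older
    term gains the factor \<open>1 - x (Suc n)\<close>.\<close>
  then have "?s (Suc n) = ?s n * of_real (1 - x (Suc n)) + z (Suc n)"
    by (simp add: sum.cl_ivl_Suc sum_distrib_right)
  then have "norm (?s (Suc n)) \<le> norm (?s n) * (1 - x (Suc n)) + x (Suc n)"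
    using x norm_triangle_ineq[of "?s n * of_real (1 - x (Suc n))" "z (Suc n)"]
    by (simp add: norm_mult del: of_real_diff of_real_prod)
  also have "\<dots> \<le> (1 - ?P) * (1 - x (Suc n)) + x (Suc n)"
    using Suc x by (intro add_right_mono mult_right_mono) auto
  finally show ?case
    by (simp add: prod.cl_ivl_Suc algebra_simps)
qed simp

text \<open>A Weierstrass approximation with error \<open>e / 2\<close> is raised by
  \<open>e / 2\<close>. It must lie above the root because the telescoping bound needs weights that
  dominate \<open>|f_i|\<close>.\<close>

lemma sqrt_polynomial_majorant:
  assumes "e > 0"
  obtains p where "real_polynomial_function p"
    "\<And>s. s \<in> {0..1} \<Longrightarrow> sqrt s \<le> p s \<and> p s \<le> sqrt s + e"
proof -
  obtain g where g: "real_polynomial_function g" "\<And>s. s \<in> {0..1::real} \<Longrightarrow> \<bar>sqrt s - g s\<bar> < e / 2"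
  proof (rule Stone_Weierstrass_real_polynomial_function)
    show "continuous_on {0..1} sqrt" by (intro continuous_intros)
    show "0 < e / 2" using assms by simp
  qed auto
  show ?thesis
  proof
    show "real_polynomial_function (\<lambda>s. g s + e / 2)"
      by (rule real_polynomial_function.intros(3)[OF g(1) real_polynomial_function.intros(2)])
    show "sqrt s \<le> g s + e / 2 \<and> g s + e / 2 \<le> sqrt s + e" if "s \<in> {0..1}" for s
      using g(2)[OF that] by linarith
  qed
qed

section \<open>Correlations of exponential sums and the contribution of one class\<close>

text \<open>Cauchy-Schwarz would give \<open>sqrt (card A * card A')\<close>, and the hypothesis
  turns this into the stated bound. The proof integrates a weighted arithmetic-geometric mean
  inequality instead.\<close>

lemma integral_norm_exp_sum_mult_le:
  assumes A: "finite A" and A': "finite A'" and le: "9 ^ k * card A \<le> card A'"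
  shows "integral {0..1} (\<lambda>t. norm (exp_sum A t) * norm (exp_sum A' t)) \<le> real (card A') / 3 ^ k"
proof (cases "card A = 0")
  case True
  then show ?thesis using A by (simp add: exp_sum_def)
next
  case False
  define a where "a = real (card A)"
  define b where "b = real (card A')"
  have a: "a > 0" and b: "9 ^ k * a \<le> b"
    using False le of_nat_mono[OF le, where 'a = real] by (auto simp: a_def b_def)
  have bpos: "b > 0" using a b by (smt (verit) mult_pos_pos zero_less_power)
  define u where "u t = norm (exp_sum A t)" for t
  define v where "v t = norm (exp_sum A' t)" for t
  have u: "((\<lambda>t. (u t)\<^sup>2) has_integral a) {0..1}" and v: "((\<lambda>t. (v t)\<^sup>2) has_integral b) {0..1}"
    unfolding u_def v_def a_def b_def by (intro has_integral_norm_exp_sum_squared A A')+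
  have "(\<lambda>t. u t * v t) integrable_on {0..1}"
    unfolding u_def v_def
    by (intro integrable_continuous_real continuous_intros trig_poly_continuous[OF trig_poly_exp_sum[OF order_refl]])
  \<comment> \<open>The weight \<open>3 ^ k * a / b\<close> equals the optimal
    \<open>sqrt (a / b)\<close> in the extremal case \<open>b = 9 ^ k * a\<close>.\<close>
  moreover have "((\<lambda>t. b / (3 ^ k * a) / 2 * (u t)\<^sup>2 + 3 ^ k * a / b / 2 * (v t)\<^sup>2) has_integral
      (b / (3 ^ k * a) / 2 * a + 3 ^ k * a / b / 2 * b)) {0..1}"
    by (intro has_integral_add has_integral_mult_right u v)
  moreover have "u t * v t \<le> b / (3 ^ k * a) / 2 * (u t)\<^sup>2 + 3 ^ k * a / b / 2 * (v t)\<^sup>2" for t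
  proof -
    define c where "c = 3 ^ k * a / b"
    have c: "c > 0" using a bpos by (simp add: c_def)
    have "0 \<le> (u t - c * v t)\<^sup>2 / (2 * c)" using c by simp
    also have "\<dots> = (1 / c) / 2 * (u t)\<^sup>2 + c / 2 * (v t)\<^sup>2 - u t * v t"
      using c by (simp add: power2_eq_square field_simps)
    finally show ?thesis by (simp add: c_def)
  qed
  ultimately have "integral {0..1} (\<lambda>t. u t * v t) \<le> b / (3 ^ k * a) / 2 * a + 3 ^ k * a / b / 2 * b"
    by (intro has_integral_le[OF integrable_integral]) auto
  also have "\<dots> = b / 3 ^ k / 2 + 3 ^ k * a / 2"
    using a bpos by simp
  also have "3 ^ k * a \<le> b / 3 ^ k"
    using b by (simp add: field_simps flip: power_mult_distrib)
  finally show ?thesis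
    by (simp add: u_def v_def b_def)
qed

text \<open>Undamped, \<open>exp_sum A\<close> paired with its normalization gives exactly 1.
  Damping costs at most 1/2, and the cross term with \<open>g\<close> costs 1/20 of the main term
  plus another 1/20 from the square mean of \<open>g\<close>, which leaves 2/5.\<close>

lemma Re_pairing_ge:
  assumes A: "finite A" "A \<noteq> {}" and g: "g \<in> L1_circle"
    and I: "((\<lambda>t. (norm (g t))\<^sup>2) has_integral I) {0..1}" "I \<le> real (card A) / 100"
    and P: "trig_poly S (\<lambda>t. of_real (P t))" "\<And>t. 0 \<le> P t \<and> P t \<le> 1"
    and int: "integral {0..1} (\<lambda>t. norm (exp_sum A t) * (1 - P t)) \<le> 1 / 2"
  shows "Re (integral {0..1} (\<lambda>t. (exp_sum A t + g t) * cnj (exp_sum A t / of_nat (card A) * of_real (P t)))) \<ge> 2 / 5"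
proof -
  define N where "N = real (card A)"
  have N: "N > 0" using A by (auto simp: N_def)
  define h where "h t = exp_sum A t / of_real N * of_real (P t)" for t
  have h: "trig_poly UNIV h"
  proof -
    have "trig_poly UNIV (\<lambda>t. inverse (of_real N) * exp_sum A t)"
      by (rule trig_poly_mult[OF trig_poly_const trig_poly_exp_sum]) auto
    from trig_poly_mult[OF this P(1), of UNIV] show ?thesis
      by (simp add: h_def[abs_def] divide_inverse mult.commute)
  qed
  have cont: "continuous_on {0..1} (exp_sum A)"
    by (rule trig_poly_continuous[OF trig_poly_exp_sum[OF order_refl]])
  have contP: "continuous_on {0..1} P"
    using continuous_on_Re[OF trig_poly_continuous[OF P(1)]] by simp
  have int1: "((\<lambda>t. (exp_sum A t + g t) * cnj (h t)) has_integral
      integral {0..1} (\<lambda>t. (exp_sum A t + g t) * cnj (h t))) {0..1}"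
    by (intro integrable_integral set_lebesgue_integral_eq_integral L1_circle_times_cnj_trig_poly[OF _ h]
        L1_circle_add exp_sum_L1_circle g)
  have int2: "((\<lambda>t. norm (exp_sum A t) * (1 - P t)) has_integral
      integral {0..1} (\<lambda>t. norm (exp_sum A t) * (1 - P t))) {0..1}"
    by (intro integrable_integral integrable_continuous_real continuous_intros cont contP)
  \<comment> \<open>A pointwise minorant made only of quantities whose integrals are known or
    bounded.\<close>
  let ?lower = "\<lambda>t. 19 / (20 * N) * (norm (exp_sum A t))\<^sup>2 - norm (exp_sum A t) * (1 - P t) - 5 / N * (norm (g t))\<^sup>2"
  have "(?lower has_integral (19 / (20 * N) * N -
      integral {0..1} (\<lambda>t. norm (exp_sum A t) * (1 - P t)) - 5 / N * I)) {0..1}"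
    using has_integral_norm_exp_sum_squared[OF A(1)]
    by (intro has_integral_diff has_integral_mult_right int2 I(1)) (simp add: N_def)
  moreover have "?lower t \<le> Re ((exp_sum A t + g t) * cnj (h t))" for t
  proof -
    define u where "u = norm (exp_sum A t)"
    define v where "v = norm (g t)"
    have u: "0 \<le> u" "u \<le> N" and v: "0 \<le> v"
      using norm_exp_sum_le[of A t] by (auto simp: u_def v_def N_def)
    have p: "0 \<le> P t" "P t \<le> 1" using P(2) by auto
    have "exp_sum A t * cnj (h t) = of_real (P t / N) * (exp_sum A t * cnj (exp_sum A t))"
      by (simp add: h_def)
    also have "\<dots> = of_real (P t / N * u\<^sup>2)"
      by (simp add: u_def flip: complex_norm_square)
    finally have 1: "Re (exp_sum A t * cnj (h t)) = P t / N * u\<^sup>2"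
      by (metis Re_complex_of_real)
    have "norm (g t * cnj (h t)) = v * (u / N * P t)"
      using N p by (simp add: norm_mult norm_divide h_def u_def v_def)
    then have 2: "Re (g t * cnj (h t)) \<ge> - (v * (u / N * P t))"
      by (metis abs_Re_le_cmod abs_le_iff minus_le_iff)
    have "v * (u / N * P t) \<le> v * (u / N * 1)"
      using N p u v by (intro mult_left_mono) auto
    also have "\<dots> \<le> (5 * v\<^sup>2 + u\<^sup>2 / 20) / N"
    proof -
      \<comment> \<open>The comparison of \<open>v\<close> with \<open>u / 10\<close> matches the
        hypothesis that the L^2 norm of \<open>g\<close> is at most a tenth of that of
        \<open>exp_sum A\<close>.\<close>
      have "0 \<le> 5 * (v - u / 10)\<^sup>2" by simp
      then have "v * u \<le> 5 * v\<^sup>2 + u\<^sup>2 / 20"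
        by (simp add: power2_eq_square algebra_simps)
      then show ?thesis using N by (simp add: divide_right_mono)
    qed
    finally have 3: "v * (u / N * P t) \<le> 5 / N * v\<^sup>2 + u\<^sup>2 / (20 * N)"
      by (simp add: add_divide_distrib)
    \<comment> \<open>Since \<open>u / N\<close> is at most 1, the damping loss becomes linear in
      \<open>u\<close>, the form in which \<open>int\<close> bounds it.\<close>
    have "u / N * (u * (1 - P t)) \<le> 1 * (u * (1 - P t))"
      using N p u by (intro mult_right_mono) auto
    then have 4: "u\<^sup>2 / N - u * (1 - P t) \<le> P t / N * u\<^sup>2"
      by (simp add: power2_eq_square right_diff_distrib mult_ac)
    have "?lower t = u\<^sup>2 / N - u * (1 - P t) - (5 / N * v\<^sup>2 + u\<^sup>2 / (20 * N))"
      using N by (simp add: u_def v_def field_simps)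
    also have "\<dots> \<le> Re (exp_sum A t * cnj (h t)) + Re (g t * cnj (h t))"
      using 1 2 3 4 by linarith
    finally show ?thesis by (simp add: distrib_right)
  qed
  ultimately have "19 / (20 * N) * N - integral {0..1} (\<lambda>t. norm (exp_sum A t) * (1 - P t)) - 5 / N * I
      \<le> Re (integral {0..1} (\<lambda>t. (exp_sum A t + g t) * cnj (h t)))"
    by (rule has_integral_le[OF _ has_integral_Re[OF int1]])
  moreover have "5 / N * I \<le> 1 / 20"
    using I(2) N by (simp add: N_def[symmetric] field_simps)
  moreover have "19 / (20 * N) * N = 19 / 20"
    using N by simp
  ultimately show ?thesis
    using int by (simp add: h_def N_def)
qed

lemma sum_inverse_power_3_le:
  assumes "j \<le> n"
  shows "(\<Sum>i\<in>{j+1..n}. 1 / 3 ^ (i - j)) \<le> (1 / 2 :: real)"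
proof -
  have "(\<Sum>i\<in>{j+1..n}. 1 / 3 ^ (i - j)) = (1 - 1 / 3 ^ (n - j)) / (2 :: real)"
    using assms
  proof (induction rule: dec_induct)
    case (step k)
    then have "(\<Sum>i\<in>{j+1..Suc k}. 1 / 3 ^ (i - j)) = (1 - 1 / 3 ^ (k - j)) / 2 + 1 / (3 * 3 ^ (k - j) :: real)"
      by (simp add: sum.cl_ivl_Suc Suc_diff_le)
    with step.hyps show ?case
      by (simp add: Suc_diff_le diff_divide_distrib)
  qed simp
  then show ?thesis by simp
qed

text \<open>The product inequality reduces the loss to correlations of \<open>A j\<close> with the
  later \<open>A i\<close>, which decay like \<open>3 ^ (j - i)\<close> after normalization. The
  approximation error \<open>e\<close> is paid once for each later index.\<close>

lemma integral_norm_exp_sum_damped_le: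
  fixes A :: "nat \<Rightarrow> int set" and w :: "nat \<Rightarrow> real \<Rightarrow> real"
  assumes A: "\<And>i. i \<in> {j..J} \<Longrightarrow> finite (A i) \<and> A i \<noteq> {} \<and> 9 ^ (i - j) * card (A j) \<le> card (A i)"
    and j: "j \<le> J"
    and w: "\<And>i t. i \<in> {j+1..J} \<Longrightarrow> 0 \<le> w i t \<and> w i t \<le> 2 \<and> w i t \<le> norm (exp_sum (A i) t) / card (A i) + e"
    and e: "real J * e * real (card (A j)) \<le> 1 / 2" "e \<ge> 0"
    and cont: "\<And>i. i \<in> {j+1..J} \<Longrightarrow> continuous_on {0..1} (w i)"
  shows "integral {0..1} (\<lambda>t. norm (exp_sum (A j) t) * (1 - (\<Prod>i\<in>{j+1..J}. 1 - w i t / 2))) \<le> 1 / 2"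
proof -
  define N where "N i = real (card (A i))" for i
  define u where "u i t = norm (exp_sum (A i) t)" for i t
  have N: "N i > 0" if "i \<in> {j..J}" for i
    using A[OF that] by (auto simp: N_def card_gt_0_iff)
  have contu: "continuous_on {0..1} (u i)" for i
    unfolding u_def by (intro continuous_intros trig_poly_continuous[OF trig_poly_exp_sum[OF order_refl]])
  let ?upper = "\<lambda>t. \<Sum>i\<in>{j+1..J}. (1 / N i * (u j t * u i t) + e * N j) / 2"
  have upper: "(?upper has_integral
      (\<Sum>i\<in>{j+1..J}. (1 / N i * integral {0..1} (\<lambda>t. u j t * u i t) + e * N j) / 2)) {0..1}"
  proof (intro has_integral_sum has_integral_divide has_integral_add has_integral_mult_right)
    show "((\<lambda>t. u j t * u i t) has_integral integral {0..1} (\<lambda>t. u j t * u i t)) {0..1}" for i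
      by (intro integrable_integral integrable_continuous_real continuous_intros contu)
    show "((\<lambda>t. N j) has_integral N j) {0..1::real}"
      using has_integral_const_real[of "N j" 0 1] by simp
  qed simp
  have "((\<lambda>t. u j t * (1 - (\<Prod>i\<in>{j+1..J}. 1 - w i t / 2))) has_integral
      integral {0..1} (\<lambda>t. u j t * (1 - (\<Prod>i\<in>{j+1..J}. 1 - w i t / 2)))) {0..1}"
    by (intro integrable_integral integrable_continuous_real continuous_intros contu cont) auto
  then have "integral {0..1} (\<lambda>t. u j t * (1 - (\<Prod>i\<in>{j+1..J}. 1 - w i t / 2))) \<le>
      (\<Sum>i\<in>{j+1..J}. (1 / N i * integral {0..1} (\<lambda>t. u j t * u i t) + e * N j) / 2)"
    using upper
  proof (rule has_integral_le)
    fix t :: real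
    have u: "0 \<le> u j t" "u j t \<le> N j"
      using norm_exp_sum_le[of "A j" t] by (auto simp: u_def N_def)
    have "1 - (\<Sum>i\<in>{j+1..J}. w i t / 2) \<le> (\<Prod>i\<in>{j+1..J}. 1 - w i t / 2)"
      using w by (intro one_minus_sum_le_prod) simp
    then have "u j t * (1 - (\<Prod>i\<in>{j+1..J}. 1 - w i t / 2)) \<le> u j t * (\<Sum>i\<in>{j+1..J}. w i t / 2)"
      using u by (intro mult_left_mono) auto
    also have "\<dots> \<le> ?upper t"
      unfolding sum_distrib_left
    proof (rule sum_mono)
      fix i assume i: "i \<in> {j+1..J}"
      have "u j t * w i t \<le> u j t * (u i t / N i + e)"
        using w[OF i] u by (intro mult_left_mono) (auto simp: u_def N_def)
      also have "\<dots> = 1 / N i * (u j t * u i t) + u j t * e"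
        by (simp add: algebra_simps)
      also have "u j t * e \<le> e * N j"
        using u e mult_left_mono[of "u j t" "N j" e] by (simp add: mult.commute)
      finally show "u j t * (w i t / 2) \<le> (1 / N i * (u j t * u i t) + e * N j) / 2"
        by simp
    qed
    finally show "u j t * (1 - (\<Prod>i\<in>{j+1..J}. 1 - w i t / 2)) \<le> ?upper t" .
  qed
  also have "\<dots> \<le> (\<Sum>i\<in>{j+1..J}. (1 / 3 ^ (i - j) + e * N j) / 2)"
  proof (intro sum_mono divide_right_mono add_right_mono)
    fix i assume i: "i \<in> {j+1..J}"
    then have i': "i \<in> {j..J}" by auto
    have "integral {0..1} (\<lambda>t. u j t * u i t) \<le> N i / 3 ^ (i - j)"
      unfolding u_def N_def using A[OF i'] A[of j] j by (intro integral_norm_exp_sum_mult_le) auto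
    then show "1 / N i * integral {0..1} (\<lambda>t. u j t * u i t) \<le> 1 / 3 ^ (i - j)"
      using N[OF i'] by (simp add: field_simps)
  qed simp
  also have "\<dots> = ((\<Sum>i\<in>{j+1..J}. 1 / 3 ^ (i - j)) + real (J - j) * (e * N j)) / 2"
    by (simp add: sum.distrib flip: sum_divide_distrib)
  \<comment> \<open>One half bounds the geometric series, the other the accumulated error from
    \<open>e\<close>; the outer division comes from the factors
    \<open>1 - w i t / 2\<close>.\<close>
  also have "\<dots> \<le> (1 / 2 + 1 / 2) / 2"
  proof (intro divide_right_mono add_mono sum_inverse_power_3_le j)
    have "real (J - j) * (e * N j) \<le> real J * (e * N j)"
      using e N[of j] j by (intro mult_right_mono) auto
    also have "\<dots> \<le> 1 / 2" using e by (simp add: N_def)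
    finally show "real (J - j) * (e * N j) \<le> 1 / 2" .
  qed simp
  finally show ?thesis by (simp add: u_def)
qed

section \<open>Building the test function and summing over the classes\<close>

text \<open>Nonempty classes are counted because the growth condition allows the first one to be
  empty. Each nonempty class contributes half of the 2/5 from \<open>Re_pairing_ge\<close>.\<close>

lemma integral_norm_ge_card:
  fixes B :: "int set" and q :: "nat \<Rightarrow> nat" and r :: "nat \<Rightarrow> int"
  defines "A \<equiv> \<lambda>i. B \<inter> residue_class (r i) (q i)"
  assumes B: "finite B" and q: "\<And>i. i \<in> {1..J} \<Longrightarrow> q i > 0"
    and growth: "\<And>i. i \<in> {1..<J} \<Longrightarrow> 10 * card (A i) < card (A (i + 1))"
    and dvd: "\<And>i. i \<in> {1..<J} \<Longrightarrow> q i dvd q (i + 1)"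
    and E: "E \<in> L1_circle"
    and Proj: "\<And>i. i \<in> {1..J} \<Longrightarrow> Lp_norm 2 (Proj E (r i) (q i)) \<le> ennreal (sqrt (card (A i)) / 10)"
  shows "real (card {j\<in>{1..J}. A j \<noteq> {}}) / 5 \<le> integral {0..1} (\<lambda>t. norm (exp_sum B t + E t))"
proof -
  have fin: "finite (A i)" for i
    using B by (simp add: A_def)
  have dvd_chain: "q i dvd q i'" if "1 \<le> i" "i \<le> i'" "i' \<le> J" for i i'
    using that(2,3)
  proof (induction rule: dec_induct)
    case (step k)
    then show ?case using dvd[of k] that(1) by (auto intro: dvd_trans)
  qed simp
  \<comment> \<open>The ratio 10 is relaxed to 9 so that its square root is the integer 3 used in
    the correlation bound.\<close>
  have growth_chain: "9 ^ (i' - i) * card (A i) \<le> card (A i')" if "1 \<le> i" "i \<le> i'" "i' \<le> J" for i i'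
    using that(2,3)
  proof (induction rule: dec_induct)
    case (step k)
    then show ?case using growth[of k] that(1) by (simp add: Suc_diff_le)
  qed simp
  \<comment> \<open>This makes \<open>e\<close> small enough for all \<open>j\<close> at once; the
    added ones keep \<open>D\<close> at least 1 even if \<open>J = 0\<close> or \<open>B\<close> is
    empty.\<close>
  define D where "D = (real J + 1) * (real (card B) + 1)"
  define e where "e = 1 / (2 * D)"
  have e: "e > 0" "e \<le> 1" and eJ: "real J * e * real (card (A j)) \<le> 1 / 2" for j
  proof -
    have "1 * 1 \<le> D" unfolding D_def by (intro mult_mono) auto
    then have D: "1 \<le> D" by simp
    then show "e > 0" "e \<le> 1" by (simp_all add: e_def)
    have "real J * real (card (A j)) \<le> D"
      unfolding D_def using card_mono[OF B, of "A j"] by (intro mult_mono) (auto simp: A_def)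
    then show "real J * e * real (card (A j)) \<le> 1 / 2"
      using D by (simp add: e_def divide_le_eq)
  qed
  obtain p where p: "real_polynomial_function p"
      "\<And>s. s \<in> {0..1} \<Longrightarrow> sqrt s \<le> p s \<and> p s \<le> sqrt s + e"
    using sqrt_polynomial_majorant[OF e(1)] by blast
  \<comment> \<open>If \<open>A i\<close> is empty, both the sum and the quotient by zero are 0, so
    \<open>f i\<close> vanishes.\<close>
  define f where "f i t = exp_sum (A i) t / of_nat (card (A i))" for i t
  define w where "w i t = p ((norm (f i t))\<^sup>2)" for i t
  define P where "P j t = (\<Prod>i\<in>{j+1..J}. 1 - w i t / 2)" for j t
  define G where "G t = exp_sum B t + E t" for t
  \<comment> \<open>Since \<open>w i\<close> may reach \<open>1 + e\<close>, halving brings the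
    weights into the unit interval, as the telescoping bound requires; \<open>f j\<close> is halved
    with them so that it stays dominated.\<close>
  define \<Phi> where "\<Phi> t = (\<Sum>j\<in>{1..J}. f j t / 2 * of_real (P j t))" for t
  have norm_f: "norm (f i t) = norm (exp_sum (A i) t) / card (A i)" "norm (f i t) \<le> 1" for i t
    using norm_exp_sum_le[of "A i" t] by (auto simp: f_def norm_divide divide_le_eq_1)
  have w: "norm (f i t) \<le> w i t" "w i t \<le> norm (f i t) + e" for i t
    using p(2)[of "(norm (f i t))\<^sup>2"] norm_f(2)[of i t] by (auto simp: w_def power_le_one)
  then have w2: "0 \<le> w i t" "w i t \<le> 2" for i t
    using norm_f(2)[of i t] norm_ge_zero[of "f i t"] e(2) w[of i t] by linarith+
  have P: "0 \<le> P j t \<and> P j t \<le> 1" for j t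
    unfolding P_def using w2 by (auto intro!: prod_nonneg prod_le_1)
  have trig_f: "trig_poly (residue_class (r i) (q i)) (f i)" for i
  proof -
    have "trig_poly (residue_class (r i) (q i)) (\<lambda>t. exp_sum (A i) t * inverse (of_nat (card (A i))))"
      by (rule trig_poly_mult[OF trig_poly_exp_sum trig_poly_const[of "{0}"]]) (auto simp: A_def)
    then show ?thesis by (simp add: f_def[abs_def] divide_inverse)
  qed
  have Z: "0 \<in> residue_class 0 m" "\<And>a b. a \<in> residue_class 0 m \<Longrightarrow> b \<in> residue_class 0 m \<Longrightarrow> a + b \<in> residue_class 0 m" for m
    by (simp_all add: residue_class_def cong_0_iff)
  have trig_w: "trig_poly (residue_class 0 (q i)) (\<lambda>t. of_real (w i t))" for i
    unfolding w_def
  proof (rule trig_poly_real_polynomial_function[OF Z _ p(1)])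
    \<comment> \<open>Frequencies of \<open>|f_i|^2\<close> are differences of two members of the
      same class, hence multiples of \<open>q i\<close>.\<close>
    have "trig_poly (residue_class 0 (q i)) (\<lambda>t. f i t * cnj (f i t))"
      by (rule trig_poly_mult[OF trig_f trig_poly_cnj[OF trig_f]]) (auto dest: residue_class_diff)
    then show "trig_poly (residue_class 0 (q i)) (\<lambda>t. of_real ((norm (f i t))\<^sup>2))"
      by (simp only: complex_norm_square)
  qed
  have trig_P: "trig_poly (residue_class 0 (q j)) (\<lambda>t. of_real (P j t))" if "j \<in> {1..J}" for j
    unfolding P_def of_real_prod
  proof (rule trig_poly_prod[OF Z])
    fix i assume i: "i \<in> {j+1..J}"
    have "trig_poly (residue_class 0 (q j)) (\<lambda>t. of_real (w i t))"
      using i that by (intro trig_poly_mono[OF trig_w] residue_class_0_antimono dvd_chain) auto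
    from trig_poly_add[OF trig_poly_const[OF Z(1), of _ 1] trig_poly_mult[OF trig_poly_const[OF Z(1), of _ "- 1 / 2"] this Z(2)]]
    show "trig_poly (residue_class 0 (q j)) (\<lambda>t. of_real (1 - w i t / 2))"
      by simp
  qed
  have trig_fP: "trig_poly (residue_class (r j) (q j)) (\<lambda>t. f j t * of_real (P j t))" if "j \<in> {1..J}" for j
    by (rule trig_poly_mult[OF trig_f trig_P[OF that] residue_class_add])
  have G: "G \<in> L1_circle"
    unfolding G_def by (intro L1_circle_add exp_sum_L1_circle E)
  have pairing: "2 / 5 \<le> Re (integral {0..1} (\<lambda>t. G t * cnj (f j t * of_real (P j t))))"
    if j: "j \<in> {1..J}" and ne: "A j \<noteq> {}" for j
  proof -
    let ?g = "Proj E (r j) (q j)"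
    have g: "?g \<in> L1_circle" by (rule Proj_L1_circle[OF E q[OF j]])
    obtain I where I: "((\<lambda>t. (norm (?g t))\<^sup>2) has_integral I) {0..1}" "I \<le> (sqrt (card (A j)) / 10)\<^sup>2"
      using Lp_norm_2_leD[OF g Proj[OF j]] by auto
    \<comment> \<open>Inside the class of index \<open>j\<close>, \<open>B\<close> coincides with
      \<open>A j\<close>, and \<open>E\<close> has the same coefficients as its projection.\<close>
    have "fourier_coeff G k = fourier_coeff (\<lambda>t. exp_sum (A j) t + ?g t) k"
      if "k \<in> residue_class (r j) (q j)" for k
      unfolding G_def using that
      by (simp add: fourier_coeff_add[OF exp_sum_L1_circle] E g fourier_coeff_Proj[OF E q[OF j]]
          fourier_coeff_exp_sum B fin) (simp add: A_def)
    then have eq: "integral {0..1} (\<lambda>t. G t * cnj (f j t * of_real (P j t))) =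
        integral {0..1} (\<lambda>t. (exp_sum (A j) t + ?g t) * cnj (f j t * of_real (P j t)))"
      by (rule fourier_coeff_determines_pairing[OF G L1_circle_add[OF exp_sum_L1_circle g] _ trig_fP[OF j]])
    have damped: "integral {0..1} (\<lambda>t. norm (exp_sum (A j) t) * (1 - P j t)) \<le> 1 / 2"
      unfolding P_def
    proof (rule integral_norm_exp_sum_damped_le[OF _ _ _ eJ])
      \<comment> \<open>Growth makes every class after a nonempty \<open>A j\<close> nonempty as
        well.\<close>
      show "finite (A i) \<and> A i \<noteq> {} \<and> 9 ^ (i - j) * card (A j) \<le> card (A i)" if "i \<in> {j..J}" for i
      proof -
        have le: "9 ^ (i - j) * card (A j) \<le> card (A i)" using growth_chain j that by auto
        moreover have "card (A j) > 0" using ne fin by (simp add: card_gt_0_iff)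
        ultimately have "card (A i) > 0" by (smt (verit) le_zero_eq mult_eq_0_iff not_gr_zero power_not_zero zero_neq_numeral)
        with le show ?thesis by (auto simp: card_gt_0_iff)
      qed
      show "continuous_on {0..1} (w i)" for i
        using continuous_on_Re[OF trig_poly_continuous[OF trig_w[of i]]] by simp
    qed (use j e w w2 norm_f in auto)
    have "I \<le> real (card (A j)) / 100"
      using I(2) by (simp add: power_divide)
    from Re_pairing_ge[OF fin ne g I(1) this trig_P[OF j] P damped] show ?thesis
      unfolding eq by (simp only: f_def)
  qed
  have "norm (\<Phi> t) \<le> 1" for t
  proof -
    have "norm (\<Phi> t) \<le> 1 - (\<Prod>i\<in>{1..J}. 1 - w i t / 2)"
      unfolding \<Phi>_def P_def using w w2 by (intro norm_telescoping_sum_le) (auto simp: norm_divide)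
    also have "\<dots> \<le> 1"
      using w2 by (auto intro!: prod_nonneg)
    finally show ?thesis .
  qed
  have int: "(\<lambda>t. G t * cnj (f j t * of_real (P j t))) integrable_on {0..1}" if "j \<in> {1..J}" for j
    by (intro set_lebesgue_integral_eq_integral L1_circle_times_cnj_trig_poly[OF G trig_fP[OF that]])
  have G\<Phi>: "(\<lambda>t. G t * cnj (\<Phi> t)) = (\<lambda>t. \<Sum>j\<in>{1..J}. 1 / 2 * (G t * cnj (f j t * of_real (P j t))))"
    by (simp add: \<Phi>_def sum_distrib_left)
  have int\<Phi>: "((\<lambda>t. G t * cnj (\<Phi> t)) has_integral
      (\<Sum>j\<in>{1..J}. 1 / 2 * integral {0..1} (\<lambda>t. G t * cnj (f j t * of_real (P j t))))) {0..1}"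
    unfolding G\<Phi> by (intro has_integral_sum has_integral_mult_right integrable_integral int) auto
  have "real (card {j\<in>{1..J}. A j \<noteq> {}}) / 5 = (\<Sum>j\<in>{1..J}. if A j \<noteq> {} then 1 / 5 else 0)"
    by (simp add: sum.If_cases Int_def)
  also have "\<dots> \<le> (\<Sum>j\<in>{1..J}. Re (1 / 2 * integral {0..1} (\<lambda>t. G t * cnj (f j t * of_real (P j t)))))"
  proof (rule sum_mono)
    fix j assume j: "j \<in> {1..J}"
    show "(if A j \<noteq> {} then 1 / 5 else 0) \<le> Re (1 / 2 * integral {0..1} (\<lambda>t. G t * cnj (f j t * of_real (P j t))))"
    proof (cases "A j = {}")
      case True
      then show ?thesis by (simp add: f_def exp_sum_def)
    next
      case False
      then show ?thesis using pairing[OF j False] by simp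
    qed
  qed
  also have "\<dots> = Re (integral {0..1} (\<lambda>t. G t * cnj (\<Phi> t)))"
    using int\<Phi> by (simp add: integral_unique)
  also have "\<dots> \<le> norm (integral {0..1} (\<lambda>t. G t * cnj (\<Phi> t)))"
    by (rule complex_Re_le_cmod)
  also have "\<dots> \<le> integral {0..1} (\<lambda>t. norm (G t))"
  proof (rule integral_norm_bound_integral)
    show "(\<lambda>t. G t * cnj (\<Phi> t)) integrable_on {0..1}" using int\<Phi> by blast
    show "(\<lambda>t. norm (G t)) integrable_on {0..1}"
      using G by (auto simp: L1_circle_def absolutely_integrable_on_def)
    show "norm (G t * cnj (\<Phi> t)) \<le> norm (G t)" for t
      using mult_left_mono[OF \<open>norm (\<Phi> t) \<le> 1\<close>, of "norm (G t)"] by (simp add: norm_mult)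
  qed
  finally show ?thesis by (simp add: G_def)
qed

section \<open>From nonempty classes to the number of all classes\<close>

theorem theorem8p2:
  shows "\<exists>c>0. \<forall>(B :: int set) (J :: nat) (q :: nat \<Rightarrow> nat) (r :: nat \<Rightarrow> int) (E :: real \<Rightarrow> complex).
    finite B \<longrightarrow>
    (\<forall>i\<in>{1..J}. q i > 0) \<longrightarrow>
    (\<forall>i\<in>{1..<J}. card (B \<inter> residue_class (r (i + 1)) (q (i + 1))) > 10 * card (B \<inter> residue_class (r i) (q i))) \<longrightarrow>
    (J = 1 \<longrightarrow> B \<inter> residue_class (r 1) (q 1) \<noteq> {}) \<longrightarrow>
    (\<forall>i\<in>{1..<J}. q i dvd q (i + 1)) \<longrightarrow>
    disjoint_family_on (\<lambda>i. residue_class (r i) (q i)) {1..J} \<longrightarrow>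
    E \<in> L1_circle \<longrightarrow>
    (\<forall>i\<in>{1..J}. Lp_norm 2 (Proj E (r i) (q i)) \<le> ennreal (sqrt (real (card (B \<inter> residue_class (r i) (q i)))) / 10)) \<longrightarrow>
    Lp_norm 1 (\<lambda>t. exp_sum B t + E t) \<ge> ennreal (c * real J)"
proof (intro exI[of _ "1 / 10 :: real"] conjI allI impI)
  fix B :: "int set" and J :: nat and q :: "nat \<Rightarrow> nat" and r :: "nat \<Rightarrow> int" and E :: "real \<Rightarrow> complex"
  let ?A = "\<lambda>i. B \<inter> residue_class (r i) (q i)"
  assume B: "finite B" and q: "\<forall>i\<in>{1..J}. q i > 0"
    and growth: "\<forall>i\<in>{1..<J}. card (?A (i + 1)) > 10 * card (?A i)"
    and one: "J = 1 \<longrightarrow> ?A 1 \<noteq> {}"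
    and dvd: "\<forall>i\<in>{1..<J}. q i dvd q (i + 1)"
    and E: "E \<in> L1_circle"
    and Proj: "\<forall>i\<in>{1..J}. Lp_norm 2 (Proj E (r i) (q i)) \<le> ennreal (sqrt (real (card (?A i))) / 10)"
  let ?S = "{j\<in>{1..J}. ?A j \<noteq> {}}"
  \<comment> \<open>Strict growth gives every class after the first positive cardinality, so only
    the first can be empty.\<close>
  have "{2..J} \<subseteq> ?S"
  proof
    fix i assume i: "i \<in> {2..J}"
    then have "card (?A i) > 0" using growth[rule_format, of "i - 1"] by (cases i) auto
    then show "i \<in> ?S" using i by (auto simp: card_gt_0_iff)
  qed
  then have "card {2..J} \<le> card ?S" by (intro card_mono) auto
  moreover have "card ?S = 1" if "J = 1"
  proof -
    have "?S = {1}" using one that by auto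
    then show ?thesis by simp
  qed
  \<comment> \<open>For \<open>J\<close> at least 2 this is \<open>J \<le> 2 * (J - 1)\<close>; for
    \<open>J = 1\<close> growth is vacuous and the separate nonemptiness hypothesis supplies the
    class. The factor 2 turns 1/5 into the constant 1/10.\<close>
  ultimately have "J \<le> 2 * card ?S" by (cases "J = 1") auto
  then have "1 / 10 * real J \<le> real (card ?S) / 5" by simp
  also have "\<dots> \<le> integral {0..1} (\<lambda>t. norm (exp_sum B t + E t))"
    using B q growth dvd E Proj by (intro integral_norm_ge_card) auto
  finally show "ennreal (1 / 10 * real J) \<le> Lp_norm 1 (\<lambda>t. exp_sum B t + E t)"
    by (simp only: Lp_norm_1_L1_circle[OF L1_circle_add[OF exp_sum_L1_circle E]] ennreal_leI)
qed simp

end
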